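(* For every $\delta>0$ let $U^\delta\in\mathbb{R}^{m\times m}$ be a symmetric matrix with $\|U^\delta-U\|_F\le\delta$. Then the minimization problem $$\min_{\zeta\in\mathcal C^\delta}\Big\|\sum_{k=1}^L\zeta_k\big(T^\lambda_k+\tau_1T^\mu_k+\tau_2T^\rho_k\big)-U^\delta\Big\|_F^2 \qquad (P_\delta)$$ admits a solution $\hat\zeta^\delta\in\mathcal C^\delta$. Moreover, if $\hat\zeta^\delta$ is a minimizer of $(P_\delta)$ for each $\delta>0$, then $$\hat\zeta^\delta\to\hat\zeta\quad\text{as }\delta\to0,$$ where $\hat\zeta$ is a minimizer of the noise-free problem $$\min_{\zeta\in\mathcal C}\Big\|\sum_{k=1}^L\zeta_k\big(T^\lambda_k+\tau_1T^\mu_k+\tau_2T^\rho_k\big)-U\Big\|_F^2.$$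
   Context: Let $\Omega\subset\mathbb{R}^d$ ($d=2$ or $3$) be a bounded connected open set with Lipschitz boundary $\partial\Omega=\overline{\Gamma_D}\cup\overline{\Gamma_N}$, where $\Gamma_D,\Gamma_N$ are disjoint, relatively open and connected. $\nabla^s u=\frac12(\nabla u+(\nabla u)^T)$, $\mathcal V:=\{v\in H^1(\Omega)^d:v|_{\Gamma_D}=0\}$. For coefficients $\lambda,\mu,\rho\in L^\infty(\Omega)$ with positive essential infimum and $g\in L^2(\Gamma_N)^d$, let $u^g_{\lambda,\mu,\rho}\in\mathcal V$ be the unique function with $\int_\Omega\lambda(\nabla\cdot u)(\nabla\cdot v)+2\mu\nabla^su:\nabla^sv+\rho\,u\cdot v\,dx=\int_{\Gamma_N}g\cdot v\,ds$ for all $v\in\mathcal V$. Let $\lambda_0,\mu_0,\rho_0,\lambda_1,\mu_1,\rho_1>0$ be constants, $D\Subset\Omega$, and $\lambda=\lambda_0+(\lambda_1-\lambda_0)\chi_D$, $\mu=\mu_0+(\mu_1-\mu_0)\chi_D$, $\rho=\rho_0+(\rho_1-\rho_0)\chi_D$. Let $\lambda_{\min}\le\lambda_1-\lambda_0\le\lambda_{\max}$, $\mu_{\min}\le\mu_1-\mu_0\le\mu_{\max}$, $\rho_{\min}\le\rho_1-\rho_0\le\rho_{\max}$ with $\lambda_{\min}>0$, $\mu_{\min},\rho_{\min}\ge0$, and set $$a_{\max}=\lambda_0-\frac{\lambda_0^2}{\lambda_0+\lambda_{\min}},\quad b_{\max}=\mu_0-\frac{\mu_0^2}{\mu_0+\mu_{\min}},\quad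 c_{\max}=\rho_0-\frac{\rho_0^2}{\rho_0+\rho_{\min}},\quad \tau_1=\frac{b_{\max}}{a_{\max}},\quad\tau_2=\frac{c_{\max}}{a_{\max}}.$$ The domain $\Omega$ is discretized into $L$ pairwise disjoint open pixels $B_1,\dots,B_L$ with each $\Omega\setminus B_k$ connected. Let $g_1,\dots,g_m\in L^2(\Gamma_N)^d$ be orthonormal boundary loads, $u_0^{g_i}:=u^{g_i}_{\lambda_0,\mu_0,\rho_0}$ and $u^{g_i}:=u^{g_i}_{\lambda,\mu,\rho}$. Define the $m\times m$ matrices $$(T^\lambda_k)_{i,j}=\int_{B_k}(\nabla\cdot u_0^{g_i})(\nabla\cdot u_0^{g_j})\,dx,\quad (T^\mu_k)_{i,j}=2\int_{B_k}\nabla^su_0^{g_i}:\nabla^su_0^{g_j}\,dx,\quad (T^\rho_k)_{i,j}=\int_{B_k}u_0^{g_i}\cdot u_0^{g_j}\,dx,$$ $$U_{i,j}=\int_{\Gamma_N}g_i\cdot(u_0^{g_j}-u^{g_j})\,ds.$$ $U$ is taken to be (symmetric) positive definite. $\|\cdot\|_F$ is the Frobenius norm, $I$ the identity matrix, and for symmetric matrices $A\ge B$ means $A-B$ is positive semidefinite. Set $$\beta_k:=\max\{a>0:\ U\ge aT^\lambda_k+\tau_1aT^\mu_k+\tau_2aT^\rho_k\},\qquad \beta_k^\delta:=\max\{a>0:\ U^\delta+\delta I\ge aT^\lambda_k+\tau_1aT^\mu_k+\tau_2aT^\rho_k\}$$ (equal to $+\infty$ if the set is unbounded), and $$\mathcal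 C:=\Big\{\zeta=\sum_{k=1}^L\zeta_k\chi_{B_k}:\ \zeta_k\in\mathbb{R},\ 0\le\zeta_k\le\min(a_{\max},\beta_k)\Big\},\qquad \mathcal C^\delta:=\Big\{\zeta=\sum_{k=1}^L\zeta_k\chi_{B_k}:\ \zeta_k\in\mathbb{R},\ 0\le\zeta_k\le\min(a_{\max},\beta_k^\delta)\Big\}.$$ Elements of these sets are identified with their coefficient vectors in $\mathbb{R}^L$, and convergence is in this finite-dimensional space.
   Formalization: The noise-free minimizer need not be unique, and then minimizers of (P_δ) may fail to converge; the formal claim is that every sequence δ_n→0 has a subsequence along which they converge to a noise-free minimizer, and that the whole family converges if that minimizer is unique. *)

theory Defs
  imports "HOL-Analysis.Analysis"
begin

definition hausdorff_pre :: "real \<Rightarrow> real \<Rightarrow> 'a::metric_space set \<Rightarrow> ennreal" where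
  "hausdorff_pre s r A =
     (INF C \<in> {C :: nat \<Rightarrow> 'a set.
                 (\<forall>n. bounded (C n) \<and> diameter (C n) \<le> r) \<and> A \<subseteq> (\<Union>n. C n)}.
        \<Sum>n. ennreal (unit_ball_vol s * (diameter (C n) / 2) powr s))"

definition hausdorff_outer :: "real \<Rightarrow> 'a::metric_space set \<Rightarrow> ennreal" where
  "hausdorff_outer s A = (SUP r \<in> {0<..}. hausdorff_pre s r A)"

text \<open>The measure lives on the Caratheodory-measurable sets, so it is complete. The factor
  \<^term>\<open>unit_ball_vol s\<close> above gives the normalisation in which it is the usual surface
  measure on Lipschitz surfaces when \<^term>\<open>s\<close> is the dimension of the surface.\<close>

definition hausdorff_measure :: "real \<Rightarrow> 'a::metric_space measure" where
  "hausdorff_measure s =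
     measure_of UNIV (lambda_system UNIV UNIV (hausdorff_outer s)) (hausdorff_outer s)"

lemma hausdorff_pre_countably_subadditive:
  "hausdorff_pre s r (\<Union>i. A i) \<le> (\<Sum>i. hausdorff_pre s r (A i))"
proof (rule ennreal_le_epsilon)
  fix e :: real assume e: "0 < e" and fin: "(\<Sum>i. hausdorff_pre s r (A i)) < top"
  define w :: "'a set \<Rightarrow> ennreal"
    where "w = (\<lambda>C. ennreal (unit_ball_vol s * (diameter C / 2) powr s))"
  have pos: "0 < ennreal (e * (1/2) ^ Suc i)" for i using e by simp
  have "\<exists>C. (\<forall>n. bounded (C n) \<and> diameter (C n) \<le> r) \<and> A i \<subseteq> (\<Union>n. C n) \<and>
            (\<Sum>n. w (C n)) \<le> hausdorff_pre s r (A i) + ennreal (e * (1/2) ^ Suc i)" for i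
  proof -
    have "hausdorff_pre s r (A i) \<noteq> top"
      using ennreal_suminf_lessD[OF fin, of i] by simp
    then have "hausdorff_pre s r (A i) < hausdorff_pre s r (A i) + ennreal (e * (1/2) ^ Suc i)"
      using pos[of i] by (simp add: ennreal_add_left_cancel_less less_top)
    then show ?thesis
      unfolding hausdorff_pre_def INF_less_iff w_def by (auto intro: less_imp_le)
  qed
  then obtain C where C: "\<And>i n. bounded (C i n) \<and> diameter (C i n) \<le> r"
      "\<And>i. A i \<subseteq> (\<Union>n. C i n)"
      "\<And>i. (\<Sum>n. w (C i n)) \<le> hausdorff_pre s r (A i) + ennreal (e * (1/2) ^ Suc i)"
    by metis
  define E where "E = (\<lambda>n. case prod_decode n of (i, j) \<Rightarrow> C i j)"
  have "(\<Union>i. A i) \<subseteq> (\<Union>n. E n)"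
  proof
    fix x assume "x \<in> (\<Union>i. A i)"
    then obtain i j where "x \<in> C i j" using C(2) by blast
    then have "x \<in> E (prod_encode (i, j))" by (simp add: E_def)
    then show "x \<in> (\<Union>n. E n)" by blast
  qed
  moreover have "\<forall>n. bounded (E n) \<and> diameter (E n) \<le> r"
    using C(1) by (simp add: E_def split: prod.split)
  ultimately have "hausdorff_pre s r (\<Union>i. A i) \<le> (\<Sum>n. w (E n))"
    unfolding hausdorff_pre_def w_def by (intro INF_lower) auto
  also have "\<dots> = (\<Sum>i. \<Sum>n. w (C i n))"
  proof -
    have "(w \<circ> E) = (\<lambda>(i, j). w (C i j)) \<circ> prod_decode"
      by (auto simp: E_def fun_eq_iff split: prod.split)
    then show ?thesis
      using suminf_ennreal_2dimen[of "\<lambda>i. (\<Sum>n. w (C i n))" "\<lambda>(i, j). w (C i j)"]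
      by (simp add: comp_def)
  qed
  also have "\<dots> \<le> (\<Sum>i. hausdorff_pre s r (A i) + ennreal (e * (1/2) ^ Suc i))"
    by (intro suminf_le C(3) summableI)
  also have "\<dots> = (\<Sum>i. hausdorff_pre s r (A i)) + (\<Sum>i. ennreal (e * (1/2) ^ Suc i))"
    by (intro suminf_add[symmetric] summableI)
  also have "(\<Sum>i. ennreal (e * (1/2) ^ Suc i)) = ennreal e"
    using sums_mult[OF power_half_series, of e] e
    by (intro suminf_ennreal_eq) auto
  finally show "hausdorff_pre s r (\<Union>i. A i) \<le> (\<Sum>i. hausdorff_pre s r (A i)) + ennreal e" .
qed

lemma hausdorff_pre_mono: "A \<subseteq> B \<Longrightarrow> hausdorff_pre s r A \<le> hausdorff_pre s r B"
  unfolding hausdorff_pre_def by (intro INF_superset_mono) auto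

lemma hausdorff_pre_empty: "0 < r \<Longrightarrow> hausdorff_pre s r {} = 0"
proof -
  assume "0 < r"
  then have "hausdorff_pre s r ({} :: 'a set)
     \<le> (\<Sum>n::nat. ennreal (unit_ball_vol s * (diameter ({} :: 'a set) / 2) powr s))"
    unfolding hausdorff_pre_def by (intro INF_lower) auto
  then show ?thesis by simp
qed

lemma outer_measure_space_hausdorff:
  "outer_measure_space UNIV (hausdorff_outer s :: 'a::metric_space set \<Rightarrow> ennreal)"
  unfolding outer_measure_space_def
proof (intro conjI)
  show "positive UNIV (hausdorff_outer s)"
    by (auto simp: positive_def hausdorff_outer_def hausdorff_pre_empty)
  show "increasing UNIV (hausdorff_outer s)"
    by (auto simp: increasing_def hausdorff_outer_def intro!: SUP_mono' hausdorff_pre_mono)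
  have "hausdorff_outer s (\<Union>i. A i) \<le> (\<Sum>i. hausdorff_outer s (A i))" for A :: "nat \<Rightarrow> 'a set"
    unfolding hausdorff_outer_def[of s "\<Union>i. A i"]
  proof (rule SUP_least)
    fix r :: real assume r: "r \<in> {0<..}"
    have "hausdorff_pre s r (\<Union>i. A i) \<le> (\<Sum>i. hausdorff_pre s r (A i))"
      by (rule hausdorff_pre_countably_subadditive)
    also have "\<dots> \<le> (\<Sum>i. hausdorff_outer s (A i))"
      unfolding hausdorff_outer_def using r by (intro suminf_le summableI SUP_upper)
    finally show "hausdorff_pre s r (\<Union>i. A i) \<le> (\<Sum>i. hausdorff_outer s (A i))" .
  qed
  then show "countably_subadditive UNIV (hausdorff_outer s :: 'a set \<Rightarrow> ennreal)"
    by (simp add: countably_subadditive_def)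
qed

lemma
  fixes A :: "'a::metric_space set"
  shows sets_hausdorff_measure:
    "sets (hausdorff_measure s :: 'a measure) = lambda_system UNIV UNIV (hausdorff_outer s)"
  and emeasure_hausdorff_measure:
    "A \<in> sets (hausdorff_measure s) \<Longrightarrow> emeasure (hausdorff_measure s) A = hausdorff_outer s A"
proof -
  interpret sigma_algebra "UNIV :: 'a set" UNIV
    using sigma_algebra_Pow[of "UNIV :: 'a set"] by simp
  have M: "measure_space (UNIV :: 'a set) (lambda_system UNIV UNIV (hausdorff_outer s)) (hausdorff_outer s)"
    by (rule caratheodory_lemma[OF outer_measure_space_hausdorff])
  then interpret l: sigma_algebra "UNIV :: 'a set" "lambda_system UNIV UNIV (hausdorff_outer s)"
    by (simp add: measure_space_def)
  show 1: "sets (hausdorff_measure s :: 'a measure) = lambda_system UNIV UNIV (hausdorff_outer s)"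
    unfolding hausdorff_measure_def by simp
  show "A \<in> sets (hausdorff_measure s) \<Longrightarrow> emeasure (hausdorff_measure s) A = hausdorff_outer s A"
    using M unfolding 1 unfolding hausdorff_measure_def
    by (intro emeasure_measure_of_sigma) (auto simp: measure_space_def)
qed

definition surface_on :: "(real^'d) set \<Rightarrow> (real^'d) measure" where
  "surface_on S = restrict_space (hausdorff_measure (real CARD('d) - 1)) S"

definition lipschitz_boundary :: "(real^'d) set \<Rightarrow> bool" where
  "lipschitz_boundary \<Omega> \<longleftrightarrow>
     (\<forall>x \<in> frontier \<Omega>. \<exists>e r K (\<gamma> :: real^'d \<Rightarrow> real).
        norm e = 1 \<and> 0 < r \<and> K-lipschitz_on UNIV \<gamma> \<and>
        (\<forall>y \<in> ball x r. y \<in> \<Omega> \<longleftrightarrow> y \<bullet> e < \<gamma> (y - (y \<bullet> e) *\<^sub>R e)))"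

definition boundary_partition :: "(real^'d) set \<Rightarrow> (real^'d) set \<Rightarrow> (real^'d) set \<Rightarrow> bool" where
  "boundary_partition \<Omega> \<Gamma>D \<Gamma>N \<longleftrightarrow>
     openin (top_of_set (frontier \<Omega>)) \<Gamma>D \<and> openin (top_of_set (frontier \<Omega>)) \<Gamma>N \<and>
     connected \<Gamma>D \<and> connected \<Gamma>N \<and> \<Gamma>D \<inter> \<Gamma>N = {} \<and>
     frontier \<Omega> = closure \<Gamma>D \<union> closure \<Gamma>N"

definition pixel_partition :: "(real^'d) set \<Rightarrow> ('l \<Rightarrow> (real^'d) set) \<Rightarrow> bool" where
  "pixel_partition \<Omega> B \<longleftrightarrow>
     (\<forall>k. open (B k) \<and> B k \<subseteq> \<Omega> \<and> connected (\<Omega> - B k)) \<and>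
     (\<forall>k l. k \<noteq> l \<longrightarrow> B k \<inter> B l = {}) \<and>
     closure \<Omega> = (\<Union>k. closure (B k))"

definition L2 :: "'a measure \<Rightarrow> ('a \<Rightarrow> 'b::euclidean_space) \<Rightarrow> bool" where
  "L2 M f \<longleftrightarrow> f \<in> borel_measurable M \<and> integrable M (\<lambda>x. (norm (f x))\<^sup>2)"

definition L2_conv ::
  "'a measure \<Rightarrow> (nat \<Rightarrow> 'a \<Rightarrow> 'b::euclidean_space) \<Rightarrow> ('a \<Rightarrow> 'b) \<Rightarrow> bool" where
  "L2_conv M f g \<longleftrightarrow> (\<lambda>n. \<integral>\<^sup>+ x. ennreal ((norm (f n x - g x))\<^sup>2) \<partial>M) \<longlonglongrightarrow> 0"

definition pderiv_at :: "'d \<Rightarrow> (real^'d \<Rightarrow> real) \<Rightarrow> real^'d \<Rightarrow> real" where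
  "pderiv_at j f x = frechet_derivative f (at x) (axis j 1)"

primrec Ck :: "nat \<Rightarrow> (real^'d \<Rightarrow> real) \<Rightarrow> bool" where
  "Ck 0 f \<longleftrightarrow> continuous_on UNIV f"
| "Ck (Suc k) f \<longleftrightarrow> f differentiable_on UNIV \<and> (\<forall>j. Ck k (pderiv_at j f))"

definition smooth :: "(real^'d \<Rightarrow> real) \<Rightarrow> bool" where
  "smooth f \<longleftrightarrow> (\<forall>k. Ck k f)"

definition test_function :: "(real^'d) set \<Rightarrow> (real^'d \<Rightarrow> real) \<Rightarrow> bool" where
  "test_function \<Omega> \<phi> \<longleftrightarrow>
     smooth \<phi> \<and> compact (closure {x. \<phi> x \<noteq> 0}) \<and> closure {x. \<phi> x \<noteq> 0} \<subseteq> \<Omega>"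

text \<open>The entry \<^term>\<open>G x $ i $ j\<close> is the derivative of the \<^term>\<open>i\<close>-th component of \<^term>\<open>u\<close>
  in direction \<^term>\<open>j\<close>, in agreement with \<^const>\<open>jacobian\<close>. Functions are representatives of
  their classes modulo null sets, so \<open>weak_grad\<close> and \<open>bdry_trace\<close> below choose
  representatives too; all later uses are integrals or hold almost everywhere.\<close>

definition has_weak_grad ::
  "(real^'d) set \<Rightarrow> (real^'d \<Rightarrow> real^'d) \<Rightarrow> (real^'d \<Rightarrow> real^'d^'d) \<Rightarrow> bool" where
  "has_weak_grad \<Omega> u G \<longleftrightarrow>
     L2 (lebesgue_on \<Omega>) G \<and>
     (\<forall>\<phi> i j. test_function \<Omega> \<phi> \<longrightarrow>
        (LINT x|lebesgue_on \<Omega>. u x $ i * pderiv_at j \<phi> x) =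
        - (LINT x|lebesgue_on \<Omega>. G x $ i $ j * \<phi> x))"

definition H1 :: "(real^'d) set \<Rightarrow> (real^'d \<Rightarrow> real^'d) set" where
  "H1 \<Omega> = {u. L2 (lebesgue_on \<Omega>) u \<and> (\<exists>G. has_weak_grad \<Omega> u G)}"

definition weak_grad :: "(real^'d) set \<Rightarrow> (real^'d \<Rightarrow> real^'d) \<Rightarrow> real^'d \<Rightarrow> real^'d^'d" where
  "weak_grad \<Omega> u = (SOME G. has_weak_grad \<Omega> u G)"

text \<open>The trace is the continuous extension to \<open>H1\<close> of the restriction of functions that are
  smooth up to the boundary, which are dense in \<open>H1\<close> of a bounded Lipschitz domain.\<close>

definition has_trace ::
  "(real^'d) set \<Rightarrow> (real^'d \<Rightarrow> real^'d) \<Rightarrow> (real^'d \<Rightarrow> real^'d) \<Rightarrow> bool" where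
  "has_trace \<Omega> u t \<longleftrightarrow>
     L2 (surface_on (frontier \<Omega>)) t \<and>
     (\<exists>\<phi> :: nat \<Rightarrow> real^'d \<Rightarrow> real^'d.
        (\<forall>n i. smooth (\<lambda>x. \<phi> n x $ i)) \<and>
        L2_conv (lebesgue_on \<Omega>) \<phi> u \<and>
        L2_conv (lebesgue_on \<Omega>) (\<lambda>n x. jacobian (\<phi> n) (at x)) (weak_grad \<Omega> u) \<and>
        L2_conv (surface_on (frontier \<Omega>)) \<phi> t)"

definition bdry_trace :: "(real^'d) set \<Rightarrow> (real^'d \<Rightarrow> real^'d) \<Rightarrow> real^'d \<Rightarrow> real^'d" where
  "bdry_trace \<Omega> u = (SOME t. has_trace \<Omega> u t)"

definition V_space :: "(real^'d) set \<Rightarrow> (real^'d) set \<Rightarrow> (real^'d \<Rightarrow> real^'d) set" where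
  "V_space \<Omega> \<Gamma>D = {v \<in> H1 \<Omega>. AE x in surface_on \<Gamma>D. bdry_trace \<Omega> v x = 0}"

definition divg :: "(real^'d) set \<Rightarrow> (real^'d \<Rightarrow> real^'d) \<Rightarrow> real^'d \<Rightarrow> real" where
  "divg \<Omega> u x = trace (weak_grad \<Omega> u x)"

definition symgrad :: "(real^'d) set \<Rightarrow> (real^'d \<Rightarrow> real^'d) \<Rightarrow> real^'d \<Rightarrow> real^'d^'d" where
  "symgrad \<Omega> u x = (1/2) *\<^sub>R (weak_grad \<Omega> u x + transpose (weak_grad \<Omega> u x))"

text \<open>The inner product of two matrices of type \<^typ>\<open>real^'d^'d\<close> is the Frobenius product.\<close>

definition weak_solution ::
  "(real^'d) set \<Rightarrow> (real^'d) set \<Rightarrow> (real^'d) set \<Rightarrow>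
   (real^'d \<Rightarrow> real) \<Rightarrow> (real^'d \<Rightarrow> real) \<Rightarrow> (real^'d \<Rightarrow> real) \<Rightarrow>
   (real^'d \<Rightarrow> real^'d) \<Rightarrow> (real^'d \<Rightarrow> real^'d) \<Rightarrow> bool" where
  "weak_solution \<Omega> \<Gamma>D \<Gamma>N lam mu rho g u \<longleftrightarrow>
     u \<in> V_space \<Omega> \<Gamma>D \<and>
     (\<forall>v \<in> V_space \<Omega> \<Gamma>D.
        (LINT x|lebesgue_on \<Omega>.
            lam x * divg \<Omega> u x * divg \<Omega> v x
            + 2 * mu x * (symgrad \<Omega> u x \<bullet> symgrad \<Omega> v x)
            + rho x * (u x \<bullet> v x)) =
        (LINT x|surface_on \<Gamma>N. g x \<bullet> bdry_trace \<Omega> v x))"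

definition two_phase :: "real \<Rightarrow> real \<Rightarrow> (real^'d) set \<Rightarrow> real^'d \<Rightarrow> real" where
  "two_phase p0 p1 D x = p0 + (p1 - p0) * indicator D x"

definition T_lam ::
  "(real^'d) set \<Rightarrow> ('m::finite \<Rightarrow> real^'d \<Rightarrow> real^'d) \<Rightarrow> (real^'d) set \<Rightarrow> real^'m^'m" where
  "T_lam \<Omega> u0 S = (\<chi> i j. LINT x|lebesgue_on S. divg \<Omega> (u0 i) x * divg \<Omega> (u0 j) x)"

definition T_mu ::
  "(real^'d) set \<Rightarrow> ('m::finite \<Rightarrow> real^'d \<Rightarrow> real^'d) \<Rightarrow> (real^'d) set \<Rightarrow> real^'m^'m" where
  "T_mu \<Omega> u0 S = (\<chi> i j. 2 * (LINT x|lebesgue_on S. symgrad \<Omega> (u0 i) x \<bullet> symgrad \<Omega> (u0 j) x))"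

definition T_rho ::
  "('m::finite \<Rightarrow> real^'d \<Rightarrow> real^'d) \<Rightarrow> (real^'d) set \<Rightarrow> real^'m^'m" where
  "T_rho u0 S = (\<chi> i j. LINT x|lebesgue_on S. u0 i x \<bullet> u0 j x)"

definition U_mat ::
  "(real^'d) set \<Rightarrow> (real^'d) set \<Rightarrow> ('m::finite \<Rightarrow> real^'d \<Rightarrow> real^'d) \<Rightarrow>
   ('m \<Rightarrow> real^'d \<Rightarrow> real^'d) \<Rightarrow> ('m \<Rightarrow> real^'d \<Rightarrow> real^'d) \<Rightarrow> real^'m^'m" where
  "U_mat \<Omega> \<Gamma>N g u0 u =
     (\<chi> i j. LINT x|surface_on \<Gamma>N. g i x \<bullet> (bdry_trace \<Omega> (u0 j) x - bdry_trace \<Omega> (u j) x))"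

definition contrast_bound :: "real \<Rightarrow> real \<Rightarrow> real" where
  "contrast_bound p0 pmin = p0 - p0\<^sup>2 / (p0 + pmin)"

definition sym_mat :: "real^'m^'m \<Rightarrow> bool" where
  "sym_mat A \<longleftrightarrow> transpose A = A"

definition pos_semidef :: "real^'m^'m \<Rightarrow> bool" where
  "pos_semidef A \<longleftrightarrow> sym_mat A \<and> (\<forall>x. 0 \<le> x \<bullet> (A *v x))"

definition pos_def :: "real^'m^'m \<Rightarrow> bool" where
  "pos_def A \<longleftrightarrow> sym_mat A \<and> (\<forall>x. x \<noteq> 0 \<longrightarrow> 0 < x \<bullet> (A *v x))"

definition loewner_ge :: "real^'m^'m \<Rightarrow> real^'m^'m \<Rightarrow> bool" where
  "loewner_ge A B \<longleftrightarrow> pos_semidef (A - B)"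

lemma norm_eq_frobenius: "norm (A :: real^'m^'m) = sqrt (\<Sum>i\<in>UNIV. \<Sum>j\<in>UNIV. (A $ i $ j)\<^sup>2)"
  by (simp add: norm_vec_def L2_set_def real_sqrt_pow2 sum_nonneg)

text \<open>The set below is nonempty when \<^term>\<open>W\<close> is positive definite and closed in the positive
  reals, so the maximum exists whenever the set is bounded.\<close>

definition beta ::
  "real^'m^'m \<Rightarrow> real \<Rightarrow> real \<Rightarrow> real^'m^'m \<Rightarrow> real^'m^'m \<Rightarrow> real^'m^'m \<Rightarrow> ereal" where
  "beta W \<tau>1 \<tau>2 Tl Tm Tr =
     (let S = {a. 0 < a \<and> loewner_ge W (a *\<^sub>R Tl + (\<tau>1 * a) *\<^sub>R Tm + (\<tau>2 * a) *\<^sub>R Tr)}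
      in if bdd_above S then ereal (GREATEST a. a \<in> S) else \<infinity>)"

definition admissible :: "real \<Rightarrow> ('l::finite \<Rightarrow> ereal) \<Rightarrow> (real^'l) set" where
  "admissible amax b = {\<zeta>. \<forall>k. 0 \<le> \<zeta> $ k \<and> ereal (\<zeta> $ k) \<le> min (ereal amax) (b k)}"

definition residual :: "('l::finite \<Rightarrow> real^'m^'m) \<Rightarrow> real^'m^'m \<Rightarrow> real^'l \<Rightarrow> real" where
  "residual T W \<zeta> = (norm ((\<Sum>k\<in>UNIV. \<zeta> $ k *\<^sub>R T k) - W))\<^sup>2"

definition minimizer :: "real \<Rightarrow> ('l::finite \<Rightarrow> ereal) \<Rightarrow> ('l \<Rightarrow> real^'m^'m) \<Rightarrow> real^'m^'m \<Rightarrow> real^'l \<Rightarrow> bool" where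
  "minimizer amax b T W \<zeta> \<longleftrightarrow> is_arg_min (residual T W) (\<lambda>\<zeta>. \<zeta> \<in> admissible amax b) \<zeta>"

end

theory Submission
  imports Defs
begin

text \<open>For a positive definite \<open>W\<close> and a symmetric \<open>M\<close> the set
  \<open>{a \<ge> 0. W - a M is positive semidefinite}\<close> is a closed interval, possibly unbounded, that
  contains \<open>0\<close> and some positive number. Hence the bound \<open>\<zeta>\<^sub>k \<le> \<beta>\<^sub>k\<close>, which
  involves a possibly infinite maximum, is the same as the closed condition \<open>W \<ge> \<zeta>\<^sub>k T\<^sub>k\<close> (\<open>le_beta_iff\<close>), and the admissible set
  becomes the set \<open>loewner_box\<close> below.

  In this form both claims are soft. The box is compact and contains \<open>0\<close>, so the continuous
  residual attains its minimum. For the limit \<open>\<delta> \<rightarrow> 0\<close>, put \<open>W\<^sub>\<delta> = U\<^sub>\<delta> + \<delta> I\<close>. The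
  Frobenius norm dominates the operator norm, so \<open>U\<^sub>\<delta>\<close> being \<open>\<delta>\<close>-close to \<open>U\<close> gives
  \<open>W\<^sub>\<delta> \<ge> U\<close>. Two consequences are used: \<open>W\<^sub>\<delta>\<close> is again positive definite, and the
  noise-free admissible set lies in every noisy one. Every \<open>\<xi>\<close> admissible without noise therefore
  competes in every noisy problem, and passing to the limit along a convergent subsequence of
  minimizers shows that its limit does no worse than \<open>\<xi>\<close>; the limit is itself admissible
  because positive semidefiniteness is a closed condition.

  The noise-free problem may have several minimizers, so convergence means that every sequence
  \<open>\<delta>\<^sub>n \<rightarrow> 0\<close> has a subsequence along which the minimizers converge to a noise-free one, and that
  the whole family converges when the noise-free minimizer is unique. The second form follows from
  the first, because in a metric space a family converges as soon as each of its sequences has a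
  subsequence with the same prescribed limit.\<close>

section \<open>The Loewner order and the quadratic form\<close>

lemma sym_mat_diff: "sym_mat A \<Longrightarrow> sym_mat B \<Longrightarrow> sym_mat (A - B)"
  by (simp add: sym_mat_def transpose_def vec_eq_iff)

lemma sym_mat_add: "sym_mat A \<Longrightarrow> sym_mat B \<Longrightarrow> sym_mat (A + B)"
  by (simp add: sym_mat_def transpose_def vec_eq_iff)

lemma sym_mat_scaleR: "sym_mat A \<Longrightarrow> sym_mat (c *\<^sub>R A)"
  by (simp add: sym_mat_def transpose_def vec_eq_iff)

lemma sym_mat_1: "sym_mat (mat 1)"
  by (simp add: sym_mat_def)

lemmas sym_mat_intros = sym_mat_diff sym_mat_add sym_mat_scaleR sym_mat_1

lemma scaleR_matrix_vector_mult: "(c *\<^sub>R A) *v x = c *\<^sub>R (A *v x)"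
  for A :: "real^'n^'m"
  by (simp add: matrix_vector_mult_def vec_eq_iff sum_distrib_left mult.assoc)

lemma pos_def_imp_pos_semidef:
  assumes "pos_def A"
  shows "pos_semidef A"
proof -
  have "0 \<le> x \<bullet> (A *v x)" for x
    using assms by (cases "x = 0") (auto simp: pos_def_def less_imp_le)
  then show ?thesis
    using assms by (simp add: pos_def_def pos_semidef_def)
qed

lemma loewner_ge_iff:
  assumes "sym_mat A" "sym_mat B"
  shows "loewner_ge A B \<longleftrightarrow> (\<forall>x. x \<bullet> (B *v x) \<le> x \<bullet> (A *v x))"
  using assms
  by (simp add: loewner_ge_def pos_semidef_def sym_mat_diff matrix_vector_mult_diff_rdistrib
      inner_diff_right)

lemma norm_matrix_vector_mult_le: "norm (A *v x) \<le> norm A * norm x"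
  for A :: "real^'n^'m"
proof -
  have "norm (A *v x) = L2_set (\<lambda>i. \<bar>A $ i \<bullet> x\<bar>) UNIV"
    by (simp add: norm_vec_def[of "A *v x"] matrix_vector_mul_component)
  also have "\<dots> \<le> L2_set (\<lambda>i. norm (A $ i) * norm x) UNIV"
    by (intro L2_set_mono) (auto simp: Cauchy_Schwarz_ineq2)
  also have "\<dots> = norm A * norm x"
    by (simp add: norm_vec_def[of A] L2_set_left_distrib)
  finally show ?thesis .
qed

lemma abs_quadratic_form_le: "\<bar>x \<bullet> (A *v x)\<bar> \<le> norm A * (x \<bullet> x)"
  for A :: "real^'n^'n"
proof -
  have "\<bar>x \<bullet> (A *v x)\<bar> \<le> norm x * norm (A *v x)"
    by (rule Cauchy_Schwarz_ineq2)
  also have "\<dots> \<le> norm x * (norm A * norm x)"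
    by (intro mult_left_mono norm_matrix_vector_mult_le) simp
  finally show ?thesis
    by (simp add: dot_square_norm power2_eq_square mult_ac)
qed

text \<open>The form of \<open>A - B\<close> is at least \<open>- \<parallel>A - B\<parallel> (x \<bullet> x)\<close>, and adding \<open>d\<close> times the identity
  compensates for that. This is why the noisy thresholds are computed from \<open>U\<^sub>\<delta> + \<delta> I\<close>.\<close>

lemma loewner_ge_shift:
  assumes "sym_mat A" "sym_mat B" "norm (A - B) \<le> d"
  shows "loewner_ge (A + d *\<^sub>R mat 1) B"
proof -
  have "x \<bullet> (B *v x) \<le> x \<bullet> ((A + d *\<^sub>R mat 1) *v x)" for x
  proof -
    have "\<bar>x \<bullet> ((A - B) *v x)\<bar> \<le> d * (x \<bullet> x)"
      using abs_quadratic_form_le[of x "A - B"] mult_right_mono[OF assms(3) inner_ge_zero[of x]]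
      by linarith
    then show ?thesis
      by (simp add: matrix_vector_mult_diff_rdistrib matrix_vector_mult_add_rdistrib
          scaleR_matrix_vector_mult inner_diff_right inner_add_right)
  qed
  then show ?thesis
    using assms by (simp add: loewner_ge_iff sym_mat_intros)
qed

lemma pos_def_if_loewner_ge:
  assumes "loewner_ge A B" "pos_def B" "sym_mat A"
  shows "pos_def A"
proof -
  have "x \<bullet> (B *v x) \<le> x \<bullet> (A *v x)" for x
    using assms by (simp add: loewner_ge_iff pos_def_def)
  then show ?thesis
    using assms(2,3) unfolding pos_def_def by (blast intro: less_le_trans)
qed

lemma loewner_ge_trans:
  assumes "loewner_ge A B" "loewner_ge B C" "sym_mat A" "sym_mat B" "sym_mat C"
  shows "loewner_ge A C"
  using assms(1,2) unfolding loewner_ge_iff[OF assms(3,4)] loewner_ge_iff[OF assms(4,5)]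
    loewner_ge_iff[OF assms(3,5)] by (blast intro: order_trans)

lemma closed_pos_semidef: "closed {A :: real^'m^'m. pos_semidef A}"
proof -
  have "closed {A :: real^'m^'m. sym_mat A}"
    unfolding sym_mat_def vec_eq_iff transpose_def
    by (simp, intro closed_Collect_all closed_Collect_eq continuous_intros)
  moreover have "closed {A :: real^'m^'m. \<forall>x. 0 \<le> x \<bullet> (A *v x)}"
    unfolding matrix_vector_mult_def inner_vec_def
    by (simp, intro closed_Collect_all closed_Collect_le continuous_intros)
  ultimately show ?thesis
    unfolding pos_semidef_def by (intro closed_Collect_conj)
qed

section \<open>The threshold \<open>\<beta>\<close> as a Loewner inequality\<close>

text \<open>On the unit sphere the form of \<open>W\<close> is bounded below by some \<open>c > 0\<close> by compactness, while
  the form of \<open>M\<close> is bounded by its norm; a step of about \<open>c / \<parallel>M\<parallel>\<close> is therefore safe.\<close>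

lemma pos_def_dominates_positive_multiple:
  fixes W M :: "real^'m^'m"
  assumes W: "pos_def W" and M: "sym_mat M"
  shows "\<exists>a>0. loewner_ge W (a *\<^sub>R M)"
proof -
  have "sphere (0 :: real^'m) 1 \<noteq> {}"
    by simp
  moreover have "continuous_on (sphere 0 1) (\<lambda>x :: real^'m. x \<bullet> (W *v x))"
    by (intro continuous_intros linear_continuous_on matrix_vector_mul_bounded_linear)
  ultimately obtain z where z: "z \<in> sphere 0 1"
    and zmin: "\<And>y. y \<in> sphere 0 1 \<Longrightarrow> z \<bullet> (W *v z) \<le> y \<bullet> (W *v y)"
    using continuous_attains_inf[OF compact_sphere] by blast
  define c where "c = z \<bullet> (W *v z)"
  have c: "0 < c"
  proof -
    have "z \<noteq> 0"
      using z by auto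
    then show ?thesis
      using W by (simp add: c_def pos_def_def)
  qed
  have coercive: "c * (x \<bullet> x) \<le> x \<bullet> (W *v x)" for x
  proof (cases "x = 0")
    case False
    then have "c \<le> (x /\<^sub>R norm x) \<bullet> (W *v (x /\<^sub>R norm x))"
      unfolding c_def by (intro zmin) simp
    also have "\<dots> = (x \<bullet> (W *v x)) / (x \<bullet> x)"
      by (simp add: matrix_vector_mult_scaleR dot_square_norm power2_eq_square field_simps)
    finally show ?thesis
      using False by (simp add: pos_le_divide_eq)
  qed simp
  \<comment> \<open>The summand 1 keeps the quotient meaningful when \<open>M = 0\<close>.\<close>
  define a where "a = c / (norm M + 1)"
  have a: "0 < a" "a * norm M \<le> c"
    using c mult_left_mono[of "norm M" "norm M + 1" c]
    by (auto simp: a_def pos_divide_le_eq add_nonneg_pos)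
  have "x \<bullet> ((a *\<^sub>R M) *v x) \<le> x \<bullet> (W *v x)" for x
  proof -
    have "x \<bullet> ((a *\<^sub>R M) *v x) \<le> a * (norm M * (x \<bullet> x))"
      using abs_quadratic_form_le[of x M] a(1) by (simp add: scaleR_matrix_vector_mult)
    also have "\<dots> \<le> c * (x \<bullet> x)"
      using mult_right_mono[OF a(2) inner_ge_zero[of x]] by (simp add: mult.assoc)
    finally show ?thesis
      using coercive[of x] by linarith
  qed
  then show ?thesis
    using a(1) W M by (auto simp: loewner_ge_iff sym_mat_intros pos_def_def)
qed

text \<open>The form of \<open>W - a M\<close> is affine in \<open>a\<close> and nonnegative at \<open>a = 0\<close>.\<close>

lemma loewner_ge_scaleR_downward:
  assumes W: "pos_def W" and M: "sym_mat M"
    and a: "loewner_ge W (a *\<^sub>R M)" and t: "0 \<le> t" "t \<le> a"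
  shows "loewner_ge W (t *\<^sub>R M)"
proof -
  have sW: "sym_mat W"
    using W by (simp add: pos_def_def)
  have "t * (x \<bullet> (M *v x)) \<le> x \<bullet> (W *v x)" for x
  proof (cases "0 \<le> x \<bullet> (M *v x)")
    case True
    then have "t * (x \<bullet> (M *v x)) \<le> a * (x \<bullet> (M *v x))"
      using t by (intro mult_right_mono)
    also have "\<dots> \<le> x \<bullet> (W *v x)"
      using a sW M by (simp add: loewner_ge_iff sym_mat_intros scaleR_matrix_vector_mult)
    finally show ?thesis .
  next
    case False
    then have "t * (x \<bullet> (M *v x)) \<le> 0"
      using t by (intro mult_nonneg_nonpos) auto
    also have "0 \<le> x \<bullet> (W *v x)"
      using pos_def_imp_pos_semidef[OF W] by (simp add: pos_semidef_def)
    finally show ?thesis .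
  qed
  then show ?thesis
    using sW M by (simp add: loewner_ge_iff sym_mat_intros scaleR_matrix_vector_mult)
qed

lemma closed_loewner_ge_scaleR:
  "closed {a. loewner_ge W (a *\<^sub>R M)}"
proof -
  have "continuous_on UNIV (\<lambda>a. W - a *\<^sub>R M)"
    by (intro continuous_intros)
  from closed_vimage[OF closed_pos_semidef this] show ?thesis
    by (simp add: loewner_ge_def vimage_def)
qed

text \<open>The maximum in \<^const>\<open>beta\<close> runs over positive numbers only, so it has a meaning only if some
  positive multiple of the pencil lies below \<open>W\<close>; definiteness of \<open>W\<close>, as opposed to
  semidefiniteness, guarantees that. Being attained, the maximum then cuts off exactly a closed
  interval starting at \<open>0\<close>.\<close>

lemma le_beta_iff:
  assumes W: "pos_def W" and sym: "sym_mat Tl" "sym_mat Tm" "sym_mat Tr" and t: "0 \<le> t"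
  shows "ereal t \<le> beta W \<tau>1 \<tau>2 Tl Tm Tr \<longleftrightarrow>
         loewner_ge W (t *\<^sub>R (Tl + \<tau>1 *\<^sub>R Tm + \<tau>2 *\<^sub>R Tr))"
proof -
  define M where "M = Tl + \<tau>1 *\<^sub>R Tm + \<tau>2 *\<^sub>R Tr"
  define S where "S = {a. 0 < a \<and> loewner_ge W (a *\<^sub>R M)}"
  have M: "sym_mat M"
    unfolding M_def using sym by (intro sym_mat_intros)
  have beta: "beta W \<tau>1 \<tau>2 Tl Tm Tr = (if bdd_above S then ereal (GREATEST a. a \<in> S) else \<infinity>)"
    by (simp add: beta_def Let_def S_def M_def scaleR_add_right mult.commute)
  obtain a0 where a0: "a0 \<in> S"
    using pos_def_dominates_positive_multiple[OF W M] by (auto simp: S_def)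
  have down: "loewner_ge W (t *\<^sub>R M)" if "a \<in> S" "t \<le> a" for a
    using loewner_ge_scaleR_downward[OF W M _ t \<open>t \<le> a\<close>] that by (simp add: S_def)
  have zero: "t \<in> S" if "loewner_ge W (t *\<^sub>R M)" "t \<noteq> 0"
    using that t by (simp add: S_def)
  have "ereal t \<le> beta W \<tau>1 \<tau>2 Tl Tm Tr \<longleftrightarrow> loewner_ge W (t *\<^sub>R M)"
  proof (cases "bdd_above S")
    case True
    have "Sup S \<in> {a. loewner_ge W (a *\<^sub>R M)}"
      by (rule closed_subset_contains_Sup[OF closed_loewner_ge_scaleR])
        (use a0 True in \<open>auto simp: S_def\<close>)
    moreover have a0_le: "a0 \<le> Sup S"
      by (rule cSup_upper[OF a0 True])
    ultimately have Sup: "Sup S \<in> S"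
      using a0 by (auto simp: S_def)
    then have "(GREATEST a. a \<in> S) = Sup S"
      by (intro Greatest_equality) (auto intro: cSup_upper True)
    moreover have "t \<le> Sup S \<longleftrightarrow> loewner_ge W (t *\<^sub>R M)"
    proof
      assume "loewner_ge W (t *\<^sub>R M)"
      then show "t \<le> Sup S"
        using zero cSup_upper[OF _ True, of t] a0 a0_le by (cases "t = 0") (auto simp: S_def)
    qed (use down Sup in blast)
    ultimately show ?thesis
      using True by (simp add: beta)
  next
    case False
    then obtain a where "a \<in> S" "t \<le> a"
      by (metis bdd_above.I2 bdd_above_def linear)
    then show ?thesis
      using False down by (simp add: beta)
  qed
  then show ?thesis
    by (simp add: M_def)
qed

section \<open>The constrained least squares problem\<close>

definition loewner_box :: "real \<Rightarrow> real^'m^'m \<Rightarrow> ('l::finite \<Rightarrow> real^'m^'m) \<Rightarrow> (real^'l) set" where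
  "loewner_box amax W T =
     {\<zeta>. \<forall>k. 0 \<le> \<zeta> $ k \<and> \<zeta> $ k \<le> amax \<and> loewner_ge W (\<zeta> $ k *\<^sub>R T k)}"

lemma admissible_eq_loewner_box:
  assumes "pos_def W"
    and "\<And>k. sym_mat (Tl k)" "\<And>k. sym_mat (Tm k)" "\<And>k. sym_mat (Tr k)"
    and "\<And>k. b k = beta W \<tau>1 \<tau>2 (Tl k) (Tm k) (Tr k)"
    and "\<And>k. T k = Tl k + \<tau>1 *\<^sub>R Tm k + \<tau>2 *\<^sub>R Tr k"
  shows "admissible amax b = loewner_box amax W T"
proof -
  have "ereal t \<le> b k \<longleftrightarrow> loewner_ge W (t *\<^sub>R T k)" if "0 \<le> t" for t k
    unfolding assms(5,6) using assms(1-4) that by (rule le_beta_iff)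
  then show ?thesis
    unfolding admissible_def loewner_box_def by auto
qed

lemma minimizer_iff:
  "minimizer amax b T W \<zeta> \<longleftrightarrow>
     \<zeta> \<in> admissible amax b \<and> (\<forall>\<xi> \<in> admissible amax b. residual T W \<zeta> \<le> residual T W \<xi>)"
  by (auto simp: minimizer_def is_arg_min_linorder)

lemma loewner_box_subset_cbox: "loewner_box amax W T \<subseteq> cbox 0 (\<chi> k. amax)"
  by (auto simp: loewner_box_def mem_box_cart)

lemma zero_in_loewner_box: "pos_def W \<Longrightarrow> 0 \<le> amax \<Longrightarrow> 0 \<in> loewner_box amax W T"
  using pos_def_imp_pos_semidef[of W] by (simp add: loewner_box_def loewner_ge_def)

lemma loewner_box_mono:
  assumes "loewner_ge W' W" "sym_mat W" "sym_mat W'" "\<And>k. sym_mat (T k)"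
  shows "loewner_box amax W T \<subseteq> loewner_box amax W' T"
proof -
  have "loewner_ge W' (c *\<^sub>R T k)" if "loewner_ge W (c *\<^sub>R T k)" for c k
    by (rule loewner_ge_trans[OF assms(1) that assms(3,2) sym_mat_scaleR[OF assms(4)]])
  then show ?thesis
    by (auto simp: loewner_box_def)
qed

lemma loewner_box_limit:
  assumes \<zeta>n: "\<And>n. \<zeta>n n \<in> loewner_box amax (Wn n) T"
    and W: "Wn \<longlonglongrightarrow> W" and \<zeta>: "\<zeta>n \<longlonglongrightarrow> \<zeta>"
  shows "\<zeta> \<in> loewner_box amax W T"
  unfolding loewner_box_def
proof (intro CollectI allI conjI)
  fix k
  have comp: "(\<lambda>n. \<zeta>n n $ k) \<longlonglongrightarrow> \<zeta> $ k"
    by (rule tendsto_vec_nth[OF \<zeta>])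
  show "0 \<le> \<zeta> $ k" "\<zeta> $ k \<le> amax"
    using \<zeta>n LIMSEQ_le_const[OF comp, of 0] LIMSEQ_le_const2[OF comp, of amax]
    by (simp_all add: loewner_box_def)
  have "(\<lambda>n. Wn n - \<zeta>n n $ k *\<^sub>R T k) \<longlonglongrightarrow> W - \<zeta> $ k *\<^sub>R T k"
    by (intro tendsto_intros W comp)
  then have "W - \<zeta> $ k *\<^sub>R T k \<in> {A. pos_semidef A}"
    using \<zeta>n closed_sequentially[OF closed_pos_semidef, of "\<lambda>n. Wn n - \<zeta>n n $ k *\<^sub>R T k"]
    by (simp add: loewner_box_def loewner_ge_def)
  then show "loewner_ge W (\<zeta> $ k *\<^sub>R T k)"
    by (simp add: loewner_ge_def)
qed

lemma compact_loewner_box: "compact (loewner_box amax W T)"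
proof -
  have "closed (loewner_box amax W T)"
    unfolding closed_sequential_limits
    using loewner_box_limit[where Wn = "\<lambda>_. W" and W = W and T = T] by blast
  then show ?thesis
    using loewner_box_subset_cbox bounded_subset[OF bounded_cbox] compact_eq_bounded_closed by blast
qed

lemma minimizer_exists:
  assumes "admissible amax b = loewner_box amax W T" "pos_def W" "0 \<le> amax"
  shows "\<exists>\<zeta>. minimizer amax b T V \<zeta>"
proof -
  have "continuous_on (loewner_box amax W T) (residual T V)"
    unfolding residual_def by (intro continuous_intros)
  then show ?thesis
    using continuous_attains_inf[OF compact_loewner_box] zero_in_loewner_box[OF assms(2,3)]
    unfolding minimizer_iff assms(1) by blast
qed

text \<open>The data \<open>Vn\<close> and the constraint matrices \<open>Wn\<close> are kept apart because the noisy problem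
  shifts the latter by \<open>\<delta> I\<close>. Compactness alone only yields an admissible limit; the
  inclusion hypothesis lets a fixed competitor of the limit problem be compared with every
  \<open>\<zeta>n n\<close>, which gives optimality.\<close>

lemma minimizers_subconverge:
  assumes min: "\<And>n. minimizer amax (bn n) T (Vn n) (\<zeta>n n)"
    and box: "\<And>n. admissible amax (bn n) = loewner_box amax (Wn n) T"
      "admissible amax b = loewner_box amax W T"
    and lim: "Vn \<longlonglongrightarrow> V" "Wn \<longlonglongrightarrow> W"
    and incl: "\<And>n. admissible amax b \<subseteq> admissible amax (bn n)"
  shows "\<exists>r \<zeta>. strict_mono (r :: nat \<Rightarrow> nat) \<and> minimizer amax b T V \<zeta> \<and> (\<lambda>n. \<zeta>n (r n)) \<longlonglongrightarrow> \<zeta>"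
proof -
  have in_box: "\<zeta>n n \<in> loewner_box amax (Wn n) T" for n
    using min[of n] by (simp add: minimizer_iff box)
  then have "\<forall>n. \<zeta>n n \<in> cbox 0 (\<chi> k. amax)"
    using loewner_box_subset_cbox by blast
  then obtain r \<zeta> where r: "strict_mono (r :: nat \<Rightarrow> nat)" and \<zeta>: "(\<lambda>n. \<zeta>n (r n)) \<longlonglongrightarrow> \<zeta>"
    using compact_cbox[unfolded compact_def] unfolding comp_def by metis
  have lim_r: "(\<lambda>n. Vn (r n)) \<longlonglongrightarrow> V" "(\<lambda>n. Wn (r n)) \<longlonglongrightarrow> W"
    using lim r by (auto dest: LIMSEQ_subseq_LIMSEQ simp: comp_def)
  have "residual T V \<zeta> \<le> residual T V \<xi>" if "\<xi> \<in> admissible amax b" for \<xi>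
  proof (rule LIMSEQ_le)
    show "(\<lambda>n. residual T (Vn (r n)) (\<zeta>n (r n))) \<longlonglongrightarrow> residual T V \<zeta>"
      "(\<lambda>n. residual T (Vn (r n)) \<xi>) \<longlonglongrightarrow> residual T V \<xi>"
      unfolding residual_def by (intro tendsto_intros \<zeta> lim_r)+
    show "\<exists>N. \<forall>n\<ge>N. residual T (Vn (r n)) (\<zeta>n (r n)) \<le> residual T (Vn (r n)) \<xi>"
      using min incl that unfolding minimizer_iff by blast
  qed
  moreover have "\<zeta> \<in> admissible amax b"
    unfolding box by (rule loewner_box_limit[OF in_box lim_r(2) \<zeta>])
  ultimately show ?thesis
    using r \<zeta> by (auto simp: minimizer_iff)
qed

section \<open>From subsequences to the one-sided limit\<close>

lemma tendsto_at_right_if_subsequences: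
  fixes f :: "real \<Rightarrow> 'a::metric_space"
  assumes sub: "\<And>s. (\<And>n. a < s n) \<Longrightarrow> s \<longlonglongrightarrow> a \<Longrightarrow>
      \<exists>r. strict_mono (r :: nat \<Rightarrow> nat) \<and> (\<lambda>n. f (s (r n))) \<longlonglongrightarrow> l"
  shows "(f \<longlongrightarrow> l) (at_right a)"
  unfolding tendsto_at_iff_sequentially
proof (intro allI impI tendstoI)
  fix X :: "nat \<Rightarrow> real" and e :: real
  assume X: "\<forall>i. X i \<in> {a<..} - {a}" "X \<longlonglongrightarrow> a" and e: "0 < e"
  show "\<forall>\<^sub>F n in sequentially. dist ((f \<circ> X) n) l < e"
  proof (rule ccontr)
    assume "\<not> ?thesis"
    then obtain q where q: "strict_mono (q :: nat \<Rightarrow> nat)" "\<And>n. \<not> dist (f (X (q n))) l < e"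
      using not_eventually_sequentiallyD by fastforce
    obtain r where "(\<lambda>n. f (X (q (r n)))) \<longlonglongrightarrow> l"
      using sub[of "\<lambda>n. X (q n)"] X LIMSEQ_subseq_LIMSEQ[OF X(2) q(1)] by (auto simp: comp_def)
    then have "\<forall>\<^sub>F n in sequentially. dist (f (X (q (r n)))) l < e"
      using e by (rule tendstoD)
    then show False
      using q(2) by simp
  qed
qed

section \<open>The sensitivity matrices and the regularized problem\<close>

lemma sym_mat_T_lam: "sym_mat (T_lam \<Omega> u0 S)"
  by (simp add: sym_mat_def transpose_def T_lam_def vec_eq_iff mult.commute)

lemma sym_mat_T_mu: "sym_mat (T_mu \<Omega> u0 S)"
  by (simp add: sym_mat_def transpose_def T_mu_def vec_eq_iff inner_commute)

lemma sym_mat_T_rho: "sym_mat (T_rho u0 S)"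
  by (simp add: sym_mat_def transpose_def T_rho_def vec_eq_iff inner_commute)

lemma contrast_bound_pos: "0 < p0 \<Longrightarrow> 0 < pmin \<Longrightarrow> 0 < contrast_bound p0 pmin"
  by (simp add: contrast_bound_def power2_eq_square field_simps)

theorem theorem4:
  fixes \<Omega> \<Gamma>D \<Gamma>N D :: "(real^'d) set"
    and B :: "'l::finite \<Rightarrow> (real^'d) set"
    and g u0 u :: "'m::finite \<Rightarrow> real^'d \<Rightarrow> real^'d"
    and lam0 mu0 rho0 lam1 mu1 rho1 :: real
    and lam_min lam_max mu_min mu_max rho_min rho_max :: real
    and amax bmax cmax \<tau>1 \<tau>2 :: real
    and U :: "real^'m^'m" and T :: "'l \<Rightarrow> real^'m^'m" and b :: "'l \<Rightarrow> ereal"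
    and U\<delta> :: "real \<Rightarrow> real^'m^'m" and b\<delta> :: "real \<Rightarrow> 'l \<Rightarrow> ereal"
  assumes dim: "CARD('d) = 2 \<or> CARD('d) = 3"
    and domain: "open \<Omega>" "bounded \<Omega>" "connected \<Omega>" "lipschitz_boundary \<Omega>"
    and bdry: "boundary_partition \<Omega> \<Gamma>D \<Gamma>N"
    and inclusion: "D \<in> sets lebesgue" "compact (closure D)" "closure D \<subseteq> \<Omega>"
    and pixels: "pixel_partition \<Omega> B"
    and pos: "0 < lam0" "0 < mu0" "0 < rho0" "0 < lam1" "0 < mu1" "0 < rho1"
    and contrast:
      "lam_min \<le> lam1 - lam0" "lam1 - lam0 \<le> lam_max"
      "mu_min \<le> mu1 - mu0" "mu1 - mu0 \<le> mu_max"
      "rho_min \<le> rho1 - rho0" "rho1 - rho0 \<le> rho_max"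
      "0 < lam_min" "0 \<le> mu_min" "0 \<le> rho_min"
    and amax: "amax = contrast_bound lam0 lam_min"
    and bmax: "bmax = contrast_bound mu0 mu_min"
    and cmax: "cmax = contrast_bound rho0 rho_min"
    and tau1: "\<tau>1 = bmax / amax"
    and tau2: "\<tau>2 = cmax / amax"
    and loads: "\<And>i. L2 (surface_on \<Gamma>N) (g i)"
    and orthonormal: "\<And>i j. (LINT x|surface_on \<Gamma>N. g i x \<bullet> g j x) = (if i = j then 1 else 0)"
    and u0: "\<And>i. weak_solution \<Omega> \<Gamma>D \<Gamma>N (\<lambda>_. lam0) (\<lambda>_. mu0) (\<lambda>_. rho0) (g i) (u0 i)"
    and u: "\<And>i. weak_solution \<Omega> \<Gamma>D \<Gamma>N
                 (two_phase lam0 lam1 D) (two_phase mu0 mu1 D) (two_phase rho0 rho1 D) (g i) (u i)"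
    and U: "U = U_mat \<Omega> \<Gamma>N g u0 u" "pos_def U"
    and T: "\<And>k. T k = T_lam \<Omega> u0 (B k) + \<tau>1 *\<^sub>R T_mu \<Omega> u0 (B k) + \<tau>2 *\<^sub>R T_rho u0 (B k)"
    and b: "\<And>k. b k = beta U \<tau>1 \<tau>2 (T_lam \<Omega> u0 (B k)) (T_mu \<Omega> u0 (B k)) (T_rho u0 (B k))"
    and U\<delta>: "\<And>\<delta>. 0 < \<delta> \<Longrightarrow> sym_mat (U\<delta> \<delta>)" "\<And>\<delta>. 0 < \<delta> \<Longrightarrow> norm (U\<delta> \<delta> - U) \<le> \<delta>"
    and b\<delta>: "\<And>\<delta> k. 0 < \<delta> \<Longrightarrow> b\<delta> \<delta> k =
              beta (U\<delta> \<delta> + \<delta> *\<^sub>R mat 1) \<tau>1 \<tau>2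
                (T_lam \<Omega> u0 (B k)) (T_mu \<Omega> u0 (B k)) (T_rho u0 (B k))"
  shows "(\<forall>\<delta>>0. \<exists>\<zeta>. minimizer amax (b\<delta> \<delta>) T (U\<delta> \<delta>) \<zeta>) \<and>
    (\<forall>\<zeta>\<delta> :: real \<Rightarrow> real^'l. (\<forall>\<delta>>0. minimizer amax (b\<delta> \<delta>) T (U\<delta> \<delta>) (\<zeta>\<delta> \<delta>)) \<longrightarrow>
       (\<forall>s. (\<forall>n. 0 < s n) \<and> s \<longlonglongrightarrow> 0 \<longrightarrow>
          (\<exists>r \<zeta>. strict_mono (r :: nat \<Rightarrow> nat) \<and> minimizer amax b T U \<zeta> \<and>
                 (\<lambda>n. \<zeta>\<delta> (s (r n))) \<longlonglongrightarrow> \<zeta>)) \<and>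
       (\<forall>\<zeta>. (\<forall>\<xi>. minimizer amax b T U \<xi> \<longleftrightarrow> \<xi> = \<zeta>) \<longrightarrow> (\<zeta>\<delta> \<longlongrightarrow> \<zeta>) (at_right 0)))"
proof -
  define W where "W = (\<lambda>\<delta>. U\<delta> \<delta> + \<delta> *\<^sub>R (mat 1 :: real^'m^'m))"
  have W_eq: "U\<delta> \<delta> + \<delta> *\<^sub>R mat 1 = W \<delta>" for \<delta>
    by (simp add: W_def)
  have amax0: "0 \<le> amax"
    using contrast_bound_pos[OF pos(1) contrast(7)] by (simp add: amax)
  have symU: "sym_mat U"
    using U(2) by (simp add: pos_def_def)
  have symT: "sym_mat (T k)" for k
    unfolding T by (intro sym_mat_intros sym_mat_T_lam sym_mat_T_mu sym_mat_T_rho)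
  have symW: "sym_mat (W \<delta>)" if "0 < \<delta>" for \<delta>
    unfolding W_def using U\<delta>(1)[OF that] by (intro sym_mat_intros)
  have W_ge: "loewner_ge (W \<delta>) U" if "0 < \<delta>" for \<delta>
    unfolding W_def by (rule loewner_ge_shift[OF U\<delta>(1)[OF that] symU U\<delta>(2)[OF that]])
  have posW: "pos_def (W \<delta>)" if "0 < \<delta>" for \<delta>
    by (rule pos_def_if_loewner_ge[OF W_ge[OF that] U(2) symW[OF that]])
  have box: "admissible amax b = loewner_box amax U T"
    by (rule admissible_eq_loewner_box[OF U(2) sym_mat_T_lam sym_mat_T_mu sym_mat_T_rho b T])
  have box\<delta>: "admissible amax (b\<delta> \<delta>) = loewner_box amax (W \<delta>) T" if "0 < \<delta>" for \<delta>
    by (rule admissible_eq_loewner_box[OF posW[OF that] sym_mat_T_lam sym_mat_T_mu sym_mat_T_rho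
          b\<delta>[OF that, unfolded W_eq] T])
  have incl: "admissible amax b \<subseteq> admissible amax (b\<delta> \<delta>)" if "0 < \<delta>" for \<delta>
    unfolding box box\<delta>[OF that]
    by (rule loewner_box_mono[OF W_ge[OF that] symU symW[OF that] symT])
  have sub: "\<exists>r \<zeta>. strict_mono (r :: nat \<Rightarrow> nat) \<and> minimizer amax b T U \<zeta> \<and>
                    (\<lambda>n. \<zeta>\<delta> (s (r n))) \<longlonglongrightarrow> \<zeta>"
    if min: "\<forall>\<delta>>0. minimizer amax (b\<delta> \<delta>) T (U\<delta> \<delta>) (\<zeta>\<delta> \<delta>)"
      and s: "\<And>n. 0 < s n" "s \<longlonglongrightarrow> 0" for \<zeta>\<delta> :: "real \<Rightarrow> real^'l" and s
  proof (rule minimizers_subconverge[where bn = "\<lambda>n. b\<delta> (s n)" and Vn = "\<lambda>n. U\<delta> (s n)"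
        and Wn = "\<lambda>n. W (s n)" and W = U])
    have "(\<lambda>n. U\<delta> (s n) - U) \<longlonglongrightarrow> 0"
      using U\<delta>(2)[OF s(1)] by (intro Lim_null_comparison[OF _ s(2)]) simp
    then show lim: "(\<lambda>n. U\<delta> (s n)) \<longlonglongrightarrow> U"
      by (simp add: LIM_zero_iff)
    show "(\<lambda>n. W (s n)) \<longlonglongrightarrow> U"
      unfolding W_def using tendsto_add[OF lim tendsto_scaleR[OF s(2) tendsto_const]] by simp
  qed (use min s box box\<delta> incl in blast)+
  show ?thesis
  proof (intro conjI allI impI)
    fix \<delta> :: real assume "0 < \<delta>"
    then show "\<exists>\<zeta>. minimizer amax (b\<delta> \<delta>) T (U\<delta> \<delta>) \<zeta>"
      by (intro minimizer_exists[OF box\<delta> posW amax0])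
  next
    fix \<zeta>\<delta> :: "real \<Rightarrow> real^'l" and s :: "nat \<Rightarrow> real"
    assume "\<forall>\<delta>>0. minimizer amax (b\<delta> \<delta>) T (U\<delta> \<delta>) (\<zeta>\<delta> \<delta>)" "(\<forall>n. 0 < s n) \<and> s \<longlonglongrightarrow> 0"
    then show "\<exists>r \<zeta>. strict_mono (r :: nat \<Rightarrow> nat) \<and> minimizer amax b T U \<zeta> \<and>
                    (\<lambda>n. \<zeta>\<delta> (s (r n))) \<longlonglongrightarrow> \<zeta>"
      using sub by blast
  next
    fix \<zeta>\<delta> :: "real \<Rightarrow> real^'l" and \<zeta>
    assume min: "\<forall>\<delta>>0. minimizer amax (b\<delta> \<delta>) T (U\<delta> \<delta>) (\<zeta>\<delta> \<delta>)"
      and unique: "\<forall>\<xi>. minimizer amax b T U \<xi> \<longleftrightarrow> \<xi> = \<zeta>"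
    show "(\<zeta>\<delta> \<longlongrightarrow> \<zeta>) (at_right 0)"
      by (rule tendsto_at_right_if_subsequences) (use sub[OF min] unique in metis)
  qed
qed

end
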